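(* For every formula $A$ provable in the logic $\mathsf{K}^+$ there exists a normal realization $B$ of $A$ such that $B$ has an injective proof in the justification logic $\mathsf{J}^+$.
   Context: Formulas of $\mathsf{K}^+$ are built from propositional variables $p_0,p_1,\dots$ and $\bot$ by $\to$, $\Box$, $\Box^+$; $\neg A:=A\to\bot$, $\top:=\neg\bot$, $A\wedge B:=\neg(A\to\neg B)$, $A\vee B:=\neg A\to B$. The logic $\mathsf{K}^+$ is axiomatized by: $A\to(B\to A)$; $(A\to(B\to C))\to((A\to B)\to(A\to C))$; $\neg\neg A\to A$; $\Box(A\to B)\to(\Box A\to\Box B)$; $\Box^+(A\to B)\to(\Box^+A\to\Box^+B)$; $\Box^+A\to\Box A$; $\Box^+A\to\Box\Box^+A$; $\Box A\wedge\Box^+(A\to\Box A)\to\Box^+A$; with rules modus ponens (from $A$ and $A\to B$ infer $B$) and necessitation (from $A$ infer $\Box^+A$). Justification terms of two sorts are built simultaneously from first-sort variables $x_0,x_1,\dots$, second-sort variables $y_0,y_1,\dots$ and second-sort constants $c_0,c_1,\dots$: first-sort terms $w::=x_i\mid (w\cdot w)\mid \mathsf{head}(s)\mid\mathsf{tail}(s)\mid (w+w)$; second-sort terms $s::=y_i\mid c_i\mid (s\cdot s)\mid \mathsf{ind}(w,s)\mid (s+s)$. Justification formulas: $A::=p_i\mid\bot\mid (A\to A)\mid [w]A\mid [s]_{\mathsf{tc}}A$ ($w$ first-sort, $s$ second-sort), with the same Boolean abbreviations. $\mathsf{J}^+_0$ has the single rule modus ponens and the axioms, for all formulas $A,B,C$,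 first-sort terms $h,w$, second-sort terms $t,s$: (i) $A\to(B\to A)$; (ii) $(A\to(B\to C))\to((A\to B)\to(A\to C))$; (iii) $\neg\neg A\to A$; (iv) $[h](A\to B)\to([w]A\to[h\cdot w]B)$; (v) $[h]A\vee[w]A\to[h+w]A$; (vi) $[t]_{\mathsf{tc}}(A\to B)\to([s]_{\mathsf{tc}}A\to[t\cdot s]_{\mathsf{tc}}B)$; (vii) $[s]_{\mathsf{tc}}A\to[\mathsf{head}(s)]A$; (viii) $[s]_{\mathsf{tc}}A\to[\mathsf{tail}(s)][s]_{\mathsf{tc}}A$; (ix) $[w]A\wedge[s]_{\mathsf{tc}}(A\to[w]A)\to[\mathsf{ind}(w,s)]_{\mathsf{tc}}A$; (x) $[t]_{\mathsf{tc}}A\vee[s]_{\mathsf{tc}}A\to[t+s]_{\mathsf{tc}}A$. $\mathsf{J}^+$ is $\mathsf{J}^+_0$ plus all formulas $[c]_{\mathsf{tc}}A$ with $c$ a constant and $A$ an axiom of $\mathsf{J}^+_0$ as additional axioms. For a proof $\pi$ in $\mathsf{J}^+$, let $\mathit{cs}(\pi)$ be the set of axioms of the form $[c]_{\mathsf{tc}}A$ used in $\pi$; $\pi$ is injective if whenever $[c]_{\mathsf{tc}}A,[c]_{\mathsf{tc}}B\in\mathit{cs}(\pi)$ then $A=B$. A justification formula $B$ is a realization of a $\mathsf{K}^+$-formula $A$ if $B$ is obtained from $A$ by replacing each occurrence of $\Box$ by some first-sort term (i.e. $\Box C$ becomes $[w]C'$) and each occurrence of $\Box^+$ by some second-sort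 term (i.e. $\Box^+C$ becomes $[s]_{\mathsf{tc}}C'$). An occurrence is negative if it lies in the antecedent of an odd number of implications, positive otherwise. The realization is normal if distinct negative occurrences of $\Box$ (resp. $\Box^+$) are replaced by distinct first-sort (resp. second-sort) justification variables. *)

theory Defs
  imports Main
begin

section \<open>The modal logic of transitive closure\<close>

datatype mfm =
    MVar nat
  | MBot
  | MImp mfm mfm  (infixr "\<rightarrow>\<^sub>K" 55)
  | Box mfm
  | BoxP mfm

abbreviation MNeg :: "mfm \<Rightarrow> mfm" where
  "MNeg A \<equiv> A \<rightarrow>\<^sub>K MBot"

abbreviation MAnd :: "mfm \<Rightarrow> mfm \<Rightarrow> mfm" where
  "MAnd A B \<equiv> MNeg (A \<rightarrow>\<^sub>K MNeg B)"

inductive K_axiom :: "mfm \<Rightarrow> bool" where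
  "K_axiom (A \<rightarrow>\<^sub>K B \<rightarrow>\<^sub>K A)"
| "K_axiom ((A \<rightarrow>\<^sub>K B \<rightarrow>\<^sub>K C) \<rightarrow>\<^sub>K (A \<rightarrow>\<^sub>K B) \<rightarrow>\<^sub>K A \<rightarrow>\<^sub>K C)"
| "K_axiom (MNeg (MNeg A) \<rightarrow>\<^sub>K A)"
| "K_axiom (Box (A \<rightarrow>\<^sub>K B) \<rightarrow>\<^sub>K Box A \<rightarrow>\<^sub>K Box B)"
| "K_axiom (BoxP (A \<rightarrow>\<^sub>K B) \<rightarrow>\<^sub>K BoxP A \<rightarrow>\<^sub>K BoxP B)"
| "K_axiom (BoxP A \<rightarrow>\<^sub>K Box A)"
| "K_axiom (BoxP A \<rightarrow>\<^sub>K Box (BoxP A))"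
| "K_axiom (MAnd (Box A) (BoxP (A \<rightarrow>\<^sub>K Box A)) \<rightarrow>\<^sub>K BoxP A)"

inductive K_provable :: "mfm \<Rightarrow> bool" where
  Ax: "K_axiom A \<Longrightarrow> K_provable A"
| MP: "K_provable A \<Longrightarrow> K_provable (A \<rightarrow>\<^sub>K B) \<Longrightarrow> K_provable B"
| Nec: "K_provable A \<Longrightarrow> K_provable (BoxP A)"

section \<open>The justification logic\<close>

datatype jterm1 =
    X nat
  | App1 jterm1 jterm1
  | Head jterm2
  | Tail jterm2
  | Plus1 jterm1 jterm1
and jterm2 =
    Y nat
  | Const nat
  | App2 jterm2 jterm2
  | Ind jterm1 jterm2
  | Plus2 jterm2 jterm2

datatype jfm =
    JVar nat
  | JBot
  | JImp jfm jfm  (infixr "\<rightarrow>\<^sub>J" 55)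
  | Just jterm1 jfm
  | JustTC jterm2 jfm

abbreviation JNeg :: "jfm \<Rightarrow> jfm" where
  "JNeg A \<equiv> A \<rightarrow>\<^sub>J JBot"

abbreviation JAnd :: "jfm \<Rightarrow> jfm \<Rightarrow> jfm" where
  "JAnd A B \<equiv> JNeg (A \<rightarrow>\<^sub>J JNeg B)"

abbreviation JOr :: "jfm \<Rightarrow> jfm \<Rightarrow> jfm" where
  "JOr A B \<equiv> JNeg A \<rightarrow>\<^sub>J B"

inductive J0_axiom :: "jfm \<Rightarrow> bool" where
  "J0_axiom (A \<rightarrow>\<^sub>J B \<rightarrow>\<^sub>J A)"
| "J0_axiom ((A \<rightarrow>\<^sub>J B \<rightarrow>\<^sub>J C) \<rightarrow>\<^sub>J (A \<rightarrow>\<^sub>J B) \<rightarrow>\<^sub>J A \<rightarrow>\<^sub>J C)"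
| "J0_axiom (JNeg (JNeg A) \<rightarrow>\<^sub>J A)"
| "J0_axiom (Just h (A \<rightarrow>\<^sub>J B) \<rightarrow>\<^sub>J Just w A \<rightarrow>\<^sub>J Just (App1 h w) B)"
| "J0_axiom (JOr (Just h A) (Just w A) \<rightarrow>\<^sub>J Just (Plus1 h w) A)"
| "J0_axiom (JustTC t (A \<rightarrow>\<^sub>J B) \<rightarrow>\<^sub>J JustTC s A \<rightarrow>\<^sub>J JustTC (App2 t s) B)"
| "J0_axiom (JustTC s A \<rightarrow>\<^sub>J Just (Head s) A)"
| "J0_axiom (JustTC s A \<rightarrow>\<^sub>J Just (Tail s) (JustTC s A))"
| "J0_axiom (JAnd (Just w A) (JustTC s (A \<rightarrow>\<^sub>J Just w A)) \<rightarrow>\<^sub>J JustTC (Ind w s) A)"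
| "J0_axiom (JOr (JustTC t A) (JustTC s A) \<rightarrow>\<^sub>J JustTC (Plus2 t s) A)"

inductive J_axiom :: "jfm \<Rightarrow> bool" where
  "J0_axiom A \<Longrightarrow> J_axiom A"
| "J0_axiom A \<Longrightarrow> J_axiom (JustTC (Const c) A)"

text \<open>Proofs are trees whose leaves are the axioms used. In \<open>ModusPonens \<pi> \<rho>\<close>,
  \<open>\<pi>\<close> proves the minor premise and \<open>\<rho>\<close> the implication.\<close>

datatype jproof =
    Axiom jfm
  | ModusPonens jproof jproof

inductive J_proof_of :: "jproof \<Rightarrow> jfm \<Rightarrow> bool" where
  "J_axiom A \<Longrightarrow> J_proof_of (Axiom A) A"
| "J_proof_of \<pi> A \<Longrightarrow> J_proof_of \<rho> (A \<rightarrow>\<^sub>J B) \<Longrightarrow> J_proof_of (ModusPonens \<pi> \<rho>) B"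

fun axioms_used :: "jproof \<Rightarrow> jfm set" where
  "axioms_used (Axiom A) = {A}"
| "axioms_used (ModusPonens \<pi> \<rho>) = axioms_used \<pi> \<union> axioms_used \<rho>"

definition cs :: "jproof \<Rightarrow> jfm set" where
  "cs \<pi> = {F \<in> axioms_used \<pi>. \<exists>c A. F = JustTC (Const c) A}"

definition injective_proof :: "jproof \<Rightarrow> bool" where
  "injective_proof \<pi> \<longleftrightarrow>
    (\<forall>c A B. JustTC (Const c) A \<in> cs \<pi> \<and> JustTC (Const c) B \<in> cs \<pi> \<longrightarrow> A = B)"

section \<open>Realizations\<close>

inductive realization :: "jfm \<Rightarrow> mfm \<Rightarrow> bool" where
  "realization (JVar i) (MVar i)"
| "realization JBot MBot"
| "realization A' A \<Longrightarrow> realization B' B \<Longrightarrow> realization (A' \<rightarrow>\<^sub>J B') (A \<rightarrow>\<^sub>K B)"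
| "realization A' A \<Longrightarrow> realization (Just w A') (Box A)"
| "realization A' A \<Longrightarrow> realization (JustTC s A') (BoxP A)"

text \<open>The terms standing at the negative occurrences of the two kinds of modality, in a list with
  one entry per occurrence. The flag says whether the formula itself lies in the antecedent of an
  odd number of implications.\<close>

fun neg_terms1 :: "bool \<Rightarrow> jfm \<Rightarrow> jterm1 list" where
  "neg_terms1 neg (JVar i) = []"
| "neg_terms1 neg JBot = []"
| "neg_terms1 neg (A \<rightarrow>\<^sub>J B) = neg_terms1 (\<not> neg) A @ neg_terms1 neg B"
| "neg_terms1 neg (Just w A) = (if neg then [w] else []) @ neg_terms1 neg A"
| "neg_terms1 neg (JustTC s A) = neg_terms1 neg A"

fun neg_terms2 :: "bool \<Rightarrow> jfm \<Rightarrow> jterm2 list" where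
  "neg_terms2 neg (JVar i) = []"
| "neg_terms2 neg JBot = []"
| "neg_terms2 neg (A \<rightarrow>\<^sub>J B) = neg_terms2 (\<not> neg) A @ neg_terms2 neg B"
| "neg_terms2 neg (Just w A) = neg_terms2 neg A"
| "neg_terms2 neg (JustTC s A) = (if neg then [s] else []) @ neg_terms2 neg A"

definition normal_realization :: "jfm \<Rightarrow> mfm \<Rightarrow> bool" where
  "normal_realization B A \<longleftrightarrow> realization B A \<and>
    set (neg_terms1 False B) \<subseteq> range X \<and> distinct (neg_terms1 False B) \<and>
    set (neg_terms2 False B) \<subseteq> range Y \<and> distinct (neg_terms2 False B)"

end

theory Submission
  imports Defs "HOL-Library.Countable"
begin

text \<open>Negative modalities are realized by variables, positive ones by the sum of the first \<open>n\<close>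
  terms of an enumeration of all terms. A family indexed by \<open>n\<close> counts as provable if its members
  have, for all large \<open>n\<close>, proofs of one common shape. Internalizing a proof gives a term depending
  on its shape only, hence a fixed term, and every fixed term is eventually a summand of the
  positive terms. This avoids the usual system of equations between provisional terms.

  If the family realizing \<open>A\<close> were not provable, some Boolean valuation of families compatible with
  provability would refute it. The valuations form a Kripke model in which \<open>u\<close> succeeds \<open>v\<close> when
  \<open>u\<close> satisfies what the finitely many negative modalities true at \<open>v\<close> assert. A positive
  \<open>\<box>\<^sup>+B\<close> that holds in the model at \<open>v\<close> is justified by the induction axiom, applied to the finite
  disjunction of the descriptions of the points reachable from \<open>v\<close>. So the truth lemma holds in the
  directions dictated by polarity, and \<open>A\<close> fails in a Kripke model, against soundness.

  The proof so obtained uses the single constant \<open>c\<^sub>0\<close>. Replacing all constants by a sum of distinct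
  ones, one for each constant axiom used, makes it injective.\<close>

instance jterm1 :: countable by countable_datatype
instance jterm2 :: countable by countable_datatype

section \<open>Kripke soundness\<close>

fun ksat :: "('w \<Rightarrow> 'w \<Rightarrow> bool) \<Rightarrow> ('w \<Rightarrow> nat \<Rightarrow> bool) \<Rightarrow> 'w \<Rightarrow> mfm \<Rightarrow> bool" where
  "ksat R V w (MVar i) \<longleftrightarrow> V w i"
| "ksat R V w MBot \<longleftrightarrow> False"
| "ksat R V w (A \<rightarrow>\<^sub>K B) \<longleftrightarrow> (ksat R V w A \<longrightarrow> ksat R V w B)"
| "ksat R V w (Box A) \<longleftrightarrow> (\<forall>u. R w u \<longrightarrow> ksat R V u A)"
| "ksat R V w (BoxP A) \<longleftrightarrow> (\<forall>u. R\<^sup>+\<^sup>+ w u \<longrightarrow> ksat R V u A)"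

text \<open>Induction along an \<open>R\<close>-path from \<open>w\<close>: the second premise
  covers its first point, the third passes from each point to its successors.\<close>

lemma ksat_induction_axiom:
  assumes "R\<^sup>+\<^sup>+ w u" "\<forall>u. R w u \<longrightarrow> P u" "\<forall>u. R\<^sup>+\<^sup>+ w u \<longrightarrow> P u \<longrightarrow> (\<forall>z. R u z \<longrightarrow> P z)"
  shows "P u"
  using assms(1) by induction (use assms(2,3) in blast)+

lemma K_axiom_sound: "K_axiom A \<Longrightarrow> ksat R V w A"
  by (induction rule: K_axiom.induct)
    (auto intro: tranclp_into_tranclp2 ksat_induction_axiom[where P = "\<lambda>u. ksat R V u _"])

lemma K_sound: "K_provable A \<Longrightarrow> ksat R V w A"
  by (induction arbitrary: w rule: K_provable.induct) (auto simp: K_axiom_sound)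

section \<open>Families of formulas and valuations\<close>

text \<open>Truth values are given to whole families, so \<open>v F\<close> need not be determined
  by values at single indices.\<close>

definition valuation :: "(('i \<Rightarrow> jfm) \<Rightarrow> bool) \<Rightarrow> (('i \<Rightarrow> jfm) \<Rightarrow> bool) \<Rightarrow> bool" where
  "valuation Q v \<longleftrightarrow> (\<forall>F. Q F \<longrightarrow> v F) \<and> \<not> v (\<lambda>i. JBot) \<and>
    (\<forall>F G. v (\<lambda>i. F i \<rightarrow>\<^sub>J G i) \<longleftrightarrow> (v F \<longrightarrow> v G))"

lemma valuation_imp: "valuation Q v \<Longrightarrow> v (\<lambda>i. F i \<rightarrow>\<^sub>J G i) \<longleftrightarrow> (v F \<longrightarrow> v G)"
  and valuation_bot: "valuation Q v \<Longrightarrow> \<not> v (\<lambda>i. JBot)"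
  and valuation_sound: "valuation Q v \<Longrightarrow> Q F \<Longrightarrow> v F"
  by (auto simp: valuation_def)

lemma
  assumes v: "valuation Q v"
  shows valuation_and: "v (\<lambda>i. JAnd (F i) (G i)) \<longleftrightarrow> v F \<and> v G"
    and valuation_or: "v (\<lambda>i. JOr (F i) (G i)) \<longleftrightarrow> v F \<or> v G"
    and valuation_top: "v (\<lambda>i. JNeg JBot)"
  by (auto simp: valuation_imp[OF v] valuation_bot[OF v])

lemmas valuation_simps = valuation_imp valuation_bot valuation_and valuation_or valuation_top

text \<open>Used twice: for uniform provability of families and, with index type
  \<open>unit\<close>, for provability of single formulas from restricted constant axioms.\<close>

locale hilbert =
  fixes Q :: "('i \<Rightarrow> jfm) \<Rightarrow> bool"
  assumes ax: "(\<And>i. J0_axiom (F i)) \<Longrightarrow> Q F"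
    and mp: "Q F \<Longrightarrow> Q (\<lambda>i. F i \<rightarrow>\<^sub>J G i) \<Longrightarrow> Q G"
begin

definition theory_of :: "('i \<Rightarrow> jfm) set \<Rightarrow> bool" where
  "theory_of M \<longleftrightarrow> Collect Q \<subseteq> M \<and> (\<forall>F G. F \<in> M \<longrightarrow> (\<lambda>i. F i \<rightarrow>\<^sub>J G i) \<in> M \<longrightarrow> G \<in> M)"

lemma theory_axiom: "theory_of M \<Longrightarrow> (\<And>i. J0_axiom (F i)) \<Longrightarrow> F \<in> M"
  using ax unfolding theory_of_def by blast

lemma theory_mp: "theory_of M \<Longrightarrow> F \<in> M \<Longrightarrow> (\<lambda>i. F i \<rightarrow>\<^sub>J G i) \<in> M \<Longrightarrow> G \<in> M"
  unfolding theory_of_def by blast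

lemma theory_weaken:
  assumes "theory_of M" "G \<in> M" shows "(\<lambda>i. F i \<rightarrow>\<^sub>J G i) \<in> M"
  by (rule theory_mp[OF assms]) (rule theory_axiom[OF assms(1)], rule J0_axiom.intros)

lemma theory_distrib:
  assumes M: "theory_of M"
    and "(\<lambda>i. F i \<rightarrow>\<^sub>J G i \<rightarrow>\<^sub>J H i) \<in> M" "(\<lambda>i. F i \<rightarrow>\<^sub>J G i) \<in> M"
  shows "(\<lambda>i. F i \<rightarrow>\<^sub>J H i) \<in> M"
proof -
  have "(\<lambda>i. (F i \<rightarrow>\<^sub>J G i \<rightarrow>\<^sub>J H i) \<rightarrow>\<^sub>J (F i \<rightarrow>\<^sub>J G i) \<rightarrow>\<^sub>J F i \<rightarrow>\<^sub>J H i) \<in> M"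
    by (rule theory_axiom[OF M]) (rule J0_axiom.intros)
  from theory_mp[OF M assms(3) theory_mp[OF M assms(2) this]] show ?thesis .
qed

lemma theory_refl:
  assumes M: "theory_of M" shows "(\<lambda>i. F i \<rightarrow>\<^sub>J F i) \<in> M"
  by (rule theory_distrib[OF M, where G = "\<lambda>i. F i \<rightarrow>\<^sub>J F i"])
    (rule theory_axiom[OF M], rule J0_axiom.intros)+

lemma theory_efq:
  assumes M: "theory_of M" shows "(\<lambda>i. JBot \<rightarrow>\<^sub>J F i) \<in> M"
proof (rule theory_distrib[OF M, where G = "\<lambda>i. JNeg (JNeg (F i))"])
  show "(\<lambda>i. JBot \<rightarrow>\<^sub>J JNeg (JNeg (F i)) \<rightarrow>\<^sub>J F i) \<in> M"
    by (rule theory_weaken[OF M], rule theory_axiom[OF M], rule J0_axiom.intros)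
qed (rule theory_axiom[OF M], rule J0_axiom.intros)

text \<open>The deduction theorem in set form; closure under modus ponens comes from the
  distribution axiom.\<close>

lemma theory_extend:
  assumes M: "theory_of M"
  shows "theory_of {H. (\<lambda>i. F i \<rightarrow>\<^sub>J H i) \<in> M}" and "M \<subseteq> {H. (\<lambda>i. F i \<rightarrow>\<^sub>J H i) \<in> M}"
    and "F \<in> {H. (\<lambda>i. F i \<rightarrow>\<^sub>J H i) \<in> M}"
proof -
  show *: "M \<subseteq> {H. (\<lambda>i. F i \<rightarrow>\<^sub>J H i) \<in> M}"
    using theory_weaken[OF M] by blast
  show "theory_of {H. (\<lambda>i. F i \<rightarrow>\<^sub>J H i) \<in> M}" (is "theory_of ?M'")
    unfolding theory_of_def
  proof (intro conjI allI impI)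
    show "Collect Q \<subseteq> ?M'" using * M unfolding theory_of_def by (blast intro: order_trans)
    show "H \<in> ?M'" if "G \<in> ?M'" "(\<lambda>i. G i \<rightarrow>\<^sub>J H i) \<in> ?M'" for G H
      using theory_distrib[OF M, of F G H] that by simp
  qed
qed (simp add: theory_refl[OF M])

text \<open>If \<open>F\<close> is missing, adjoining it gives a larger theory, inconsistent by
  maximality. So \<open>M\<close> contains the negation of \<open>F\<close>, and with it every
  implication from \<open>F\<close>.\<close>

lemma maximal_theory_valuation:
  assumes M: "theory_of M" and bot: "(\<lambda>i. JBot) \<notin> M"
    and max: "\<And>M'. theory_of M' \<Longrightarrow> M \<subseteq> M' \<Longrightarrow> (\<lambda>i. JBot) \<notin> M' \<Longrightarrow> M' = M"
  shows "valuation Q (\<lambda>F. F \<in> M)"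
proof -
  have neg: "(\<lambda>i. JNeg (F i)) \<in> M" if "F \<notin> M" for F
  proof (rule ccontr)
    assume "(\<lambda>i. JNeg (F i)) \<notin> M"
    then have "{H. (\<lambda>i. F i \<rightarrow>\<^sub>J H i) \<in> M} = M"
      by (intro max[OF theory_extend(1,2)[OF M]]) simp
    then show False using theory_extend(3)[OF M, of F] that by simp
  qed
  have "(\<lambda>i. F i \<rightarrow>\<^sub>J G i) \<in> M" if "F \<notin> M" for F G
    by (rule theory_distrib[OF M _ neg[OF that]]) (rule theory_weaken[OF M], rule theory_efq[OF M])
  note nonmember = this
  show ?thesis
    unfolding valuation_def
  proof (intro conjI allI)
    show "Q F \<longrightarrow> F \<in> M" for F using M unfolding theory_of_def by blast
    show "(\<lambda>i. JBot) \<notin> M" by (rule bot)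
    show "(\<lambda>i. F i \<rightarrow>\<^sub>J G i) \<in> M \<longleftrightarrow> (F \<in> M \<longrightarrow> G \<in> M)" for F G
      using theory_weaken[OF M, of G F] theory_mp[OF M, of F G] nonmember[of F G] by argo
  qed
qed

text \<open>Lindenbaum's lemma: if \<open>F\<close> is not provable, its negation is consistent with
  \<open>Q\<close>, and Zorn's lemma yields a maximal theory whose membership predicate refutes
  \<open>F\<close>.\<close>

lemma valuation_complete:
  assumes "\<And>v. valuation Q v \<Longrightarrow> v F"
  shows "Q F"
proof (rule ccontr)
  assume nF: "\<not> Q F"
  have Q: "theory_of (Collect Q)"
    unfolding theory_of_def
  proof (intro conjI allI impI)
    show "H \<in> Collect Q" if "G \<in> Collect Q" "(\<lambda>i. G i \<rightarrow>\<^sub>J H i) \<in> Collect Q" for G H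
      using mp[of G H] that by simp
  qed simp
  define M0 where "M0 = {H. (\<lambda>i. JNeg (F i) \<rightarrow>\<^sub>J H i) \<in> Collect Q}"
  define \<C> where "\<C> = {M. theory_of M \<and> M0 \<subseteq> M \<and> (\<lambda>i. JBot) \<notin> M}"
  have dn: "(\<lambda>i. JNeg (JNeg (F i)) \<rightarrow>\<^sub>J F i) \<in> Collect Q"
    by (rule theory_axiom[OF Q]) (rule J0_axiom.intros)
  have M0: "theory_of M0" "(\<lambda>i. JNeg (F i)) \<in> M0"
    unfolding M0_def by (rule theory_extend[OF Q])+
  have "(\<lambda>i. JBot) \<notin> M0"
  proof
    assume "(\<lambda>i. JBot) \<in> M0"
    then have "(\<lambda>i. JNeg (JNeg (F i))) \<in> Collect Q" by (simp add: M0_def)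
    from theory_mp[OF Q this dn] nF show False by simp
  qed
  then have "M0 \<in> \<C>" using M0 by (simp add: \<C>_def)
  moreover have "\<Union>C \<in> \<C>" if "C \<noteq> {}" "subset.chain \<C> C" for C
  proof -
    have C: "C \<subseteq> \<C>" and lin: "\<And>M M'. M \<in> C \<Longrightarrow> M' \<in> C \<Longrightarrow> M \<subseteq> M' \<or> M' \<subseteq> M"
      using that(2) by (auto simp: subset_chain_def)
    have "theory_of (\<Union>C)"
      unfolding theory_of_def
    proof (intro conjI allI impI)
      show "Collect Q \<subseteq> \<Union>C"
        using C that(1) unfolding \<C>_def theory_of_def by blast
      fix H G assume "H \<in> \<Union>C" "(\<lambda>i. H i \<rightarrow>\<^sub>J G i) \<in> \<Union>C"
      then obtain M M' where MM': "M \<in> C" "H \<in> M" "M' \<in> C" "(\<lambda>i. H i \<rightarrow>\<^sub>J G i) \<in> M'" by (elim UnionE)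
      then obtain M'' where M'': "M'' \<in> C" "M \<subseteq> M''" "M' \<subseteq> M''"
        using lin[of M M'] by blast
      then have "theory_of M''" using C by (auto simp: \<C>_def)
      from theory_mp[OF this subsetD[OF M''(2) MM'(2)] subsetD[OF M''(3) MM'(4)]] M''(1)
      show "G \<in> \<Union>C" by (rule UnionI[rotated])
    qed
    then show ?thesis using C that(1) by (auto simp: \<C>_def)
  qed
  ultimately obtain M where M: "M \<in> \<C>" and max: "\<forall>M'\<in>\<C>. M \<subseteq> M' \<longrightarrow> M' = M"
    using subset_Zorn_nonempty[of \<C>] by blast
  have v: "valuation Q (\<lambda>F. F \<in> M)"
    by (rule maximal_theory_valuation) (use M max in \<open>auto simp: \<C>_def\<close>)
  have "(\<lambda>i. JNeg (F i)) \<in> M"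
    using M M0(2) by (auto simp: \<C>_def)
  then have "F \<notin> M"
    using valuation_imp[OF v, of F "\<lambda>i. JBot"] valuation_bot[OF v] by simp
  then show False using assms[OF v] by simp
qed

end

section \<open>Uniform provability\<close>

text \<open>A skeleton records the shape of a proof but not its formulas; \<open>Const 0\<close> may justify every axiom.\<close>

datatype skeleton = Ax0 | AxC | MP skeleton skeleton

inductive derives :: "skeleton \<Rightarrow> jfm \<Rightarrow> bool" where
  derives_Ax0: "J0_axiom A \<Longrightarrow> derives Ax0 A"
| derives_AxC: "J0_axiom A \<Longrightarrow> derives AxC (JustTC (Const 0) A)"
| derives_MP: "derives s A \<Longrightarrow> derives t (A \<rightarrow>\<^sub>J B) \<Longrightarrow> derives (MP s t) B"

inductive_cases derives_Ax0E: "derives Ax0 A"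
inductive_cases derives_AxCE: "derives AxC A"
inductive_cases derives_MPE: "derives (MP s t) A"

text \<open>The skeleton is chosen before the index, so a term read off from it serves all large
  indices at once.\<close>

definition uprov :: "'i filter \<Rightarrow> ('i \<Rightarrow> jfm) \<Rightarrow> bool" where
  "uprov \<F> F \<longleftrightarrow> (\<exists>s. \<forall>\<^sub>F i in \<F>. derives s (F i))"

lemma uprov_axiom: "(\<forall>\<^sub>F i in \<F>. J0_axiom (F i)) \<Longrightarrow> uprov \<F> F"
  unfolding uprov_def by (rule exI[of _ Ax0]) (auto elim: eventually_mono intro: derives_Ax0)

lemma uprov_const: "(\<forall>\<^sub>F i in \<F>. J0_axiom (F i)) \<Longrightarrow> uprov \<F> (\<lambda>i. JustTC (Const 0) (F i))"
  unfolding uprov_def by (rule exI[of _ AxC]) (auto elim: eventually_mono intro: derives_AxC)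

interpretation uprov: hilbert "uprov \<F>" for \<F> :: "'i filter"
proof
  show "uprov \<F> F" if "\<And>i. J0_axiom (F i)" for F
    using that by (simp add: uprov_axiom)
  show "uprov \<F> G" if F: "uprov \<F> F" and FG: "uprov \<F> (\<lambda>i. F i \<rightarrow>\<^sub>J G i)" for F G
  proof -
    obtain s t where "\<forall>\<^sub>F i in \<F>. derives s (F i)" "\<forall>\<^sub>F i in \<F>. derives t (F i \<rightarrow>\<^sub>J G i)"
      using F FG unfolding uprov_def by blast
    then have "\<forall>\<^sub>F i in \<F>. derives (MP s t) (G i)"
      by eventually_elim (rule derives_MP)
    then show ?thesis unfolding uprov_def by blast
  qed
qed

abbreviation Val :: "'i filter \<Rightarrow> (('i \<Rightarrow> jfm) \<Rightarrow> bool) \<Rightarrow> bool" where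
  "Val \<F> \<equiv> valuation (uprov \<F>)"

lemma Val_axiom: "Val \<F> v \<Longrightarrow> (\<And>i. J0_axiom (F i)) \<Longrightarrow> v F"
  by (rule valuation_sound[of "uprov \<F>"]) (simp_all add: uprov_axiom)

lemma
  assumes v: "Val \<F> v"
  shows Val_App1: "v (\<lambda>i. Just h (A i \<rightarrow>\<^sub>J B i)) \<Longrightarrow> v (\<lambda>i. Just w (A i)) \<Longrightarrow> v (\<lambda>i. Just (App1 h w) (B i))"
    and Val_App2: "v (\<lambda>i. JustTC t (A i \<rightarrow>\<^sub>J B i)) \<Longrightarrow> v (\<lambda>i. JustTC s (A i)) \<Longrightarrow> v (\<lambda>i. JustTC (App2 t s) (B i))"
    and Val_Plus1: "v (\<lambda>i. Just h (A i)) \<or> v (\<lambda>i. Just w (A i)) \<Longrightarrow> v (\<lambda>i. Just (Plus1 h w) (A i))"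
    and Val_Head: "v (\<lambda>i. JustTC s (A i)) \<Longrightarrow> v (\<lambda>i. Just (Head s) (A i))"
    and Val_Tail: "v (\<lambda>i. JustTC s (A i)) \<Longrightarrow> v (\<lambda>i. Just (Tail s) (JustTC s (A i)))"
    and Val_Ind: "v (\<lambda>i. Just w (A i)) \<Longrightarrow> v (\<lambda>i. JustTC s (A i \<rightarrow>\<^sub>J Just w (A i))) \<Longrightarrow>
      v (\<lambda>i. JustTC (Ind w s) (A i))"
  using Val_axiom[OF v, OF J0_axiom.intros(4), of "\<lambda>_. h" A B "\<lambda>_. w"]
    Val_axiom[OF v, OF J0_axiom.intros(6), of "\<lambda>_. t" A B "\<lambda>_. s"]
    Val_axiom[OF v, OF J0_axiom.intros(5), of "\<lambda>_. h" A "\<lambda>_. w"]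
    Val_axiom[OF v, OF J0_axiom.intros(7), of "\<lambda>_. s" A]
    Val_axiom[OF v, OF J0_axiom.intros(8), of "\<lambda>_. s" A]
    Val_axiom[OF v, OF J0_axiom.intros(9), of "\<lambda>_. w" A "\<lambda>_. s"]
  by (auto simp: valuation_simps[OF v])

text \<open>For \<open>AxC\<close> the formula to justify is itself of the form \<open>[c]A\<close>.
  The tail axiom justifies it only by the first-sort term \<open>Tail c\<close>; since
  \<open>c\<close> also justifies that instance of the tail axiom, \<open>Ind\<close> lifts this to
  a second-sort term.\<close>

fun reify :: "skeleton \<Rightarrow> jterm2" where
  "reify Ax0 = Const 0"
| "reify AxC = Ind (Tail (Const 0)) (Const 0)"
| "reify (MP s t) = App2 (reify t) (reify s)"

lemma derives_reify: "\<exists>s'. \<forall>A. derives s A \<longrightarrow> derives s' (JustTC (reify s) A)"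
proof (induction s)
  case Ax0
  then show ?case by (auto elim!: derives_Ax0E intro: derives_AxC)
next
  case AxC
  let ?c = "Const 0"
  \<comment> \<open>Indexing by the axioms themselves, under the principal filter, yields one
    skeleton for every \<open>A\<close>.\<close>
  let ?\<F> = "principal {A. J0_axiom A}"
  have "uprov ?\<F> (\<lambda>A. JustTC (Ind (Tail ?c) ?c) (JustTC ?c A))"
  proof (rule uprov.valuation_complete)
    fix v assume v: "Val ?\<F> v"
    have "v (\<lambda>A. JustTC ?c A)"
      by (rule valuation_sound[OF v], rule uprov_const) (simp add: eventually_principal)
    moreover have "v (\<lambda>A. JustTC ?c (JustTC ?c A \<rightarrow>\<^sub>J Just (Tail ?c) (JustTC ?c A)))"
      by (rule valuation_sound[OF v], rule uprov_const) (simp add: J0_axiom.intros)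
    ultimately show "v (\<lambda>A. JustTC (Ind (Tail ?c) ?c) (JustTC ?c A))"
      by (intro Val_Ind[OF v] Val_Tail[OF v])
  qed
  then show ?case
    by (auto simp: uprov_def eventually_principal elim!: derives_AxCE)
next
  case (MP s t)
  then obtain s' t' where st: "\<And>A. derives s A \<Longrightarrow> derives s' (JustTC (reify s) A)"
    "\<And>A. derives t A \<Longrightarrow> derives t' (JustTC (reify t) A)"
    by blast
  \<comment> \<open>The leaf \<open>Ax0\<close> is the application axiom for \<open>reify t\<close>
    and \<open>reify s\<close>.\<close>
  have "derives (MP s' (MP t' Ax0)) (JustTC (reify (MP s t)) B)" if "derives (MP s t) B" for B
    using that by (auto elim!: derives_MPE intro!: derives.intros J0_axiom.intros intro: st)
  then show ?case by blast
qed

lemma uprov_necessitation: "uprov \<F> F \<Longrightarrow> \<exists>s. uprov \<F> (\<lambda>i. JustTC s (F i))"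
proof -
  assume "uprov \<F> F"
  then obtain s where s: "\<forall>\<^sub>F i in \<F>. derives s (F i)" unfolding uprov_def ..
  obtain s' where "\<And>A. derives s A \<Longrightarrow> derives s' (JustTC (reify s) A)"
    using derives_reify by blast
  then have "\<forall>\<^sub>F i in \<F>. derives s' (JustTC (reify s) (F i))"
    using s by (rule eventually_mono[rotated])
  then show ?thesis unfolding uprov_def by blast
qed

text \<open>Completeness turns truth under all valuations into a uniform proof, whose reified
  skeleton is the term.\<close>

lemma Val_necessitation:
  assumes "\<And>v. Val \<F> v \<Longrightarrow> v F"
  shows "\<exists>s. \<forall>v. Val \<F> v \<longrightarrow> v (\<lambda>i. JustTC s (F i))"
proof -
  have "uprov \<F> F"
    by (rule uprov.valuation_complete) (rule assms)
  then obtain s where s: "uprov \<F> (\<lambda>i. JustTC s (F i))"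
    using uprov_necessitation by blast
  have "v (\<lambda>i. JustTC s (F i))" if "Val \<F> v" for v
    using that s by (rule valuation_sound)
  then show ?thesis by blast
qed

section \<open>Justifying modal steps by fixed terms\<close>

lemma ex_finite_conj:
  assumes "finite K"
  shows "\<exists>F. \<forall>v. Val \<F> v \<longrightarrow> (v F \<longleftrightarrow> (\<forall>k\<in>K. v (f k)))"
  using assms
proof induction
  case empty
  have "v (\<lambda>i. JNeg JBot) \<longleftrightarrow> (\<forall>k\<in>{}. v (f k))" if "Val \<F> v" for v
    using valuation_simps[OF that] by simp
  then show ?case by blast
next
  case (insert k K)
  then obtain F where F: "\<forall>v. Val \<F> v \<longrightarrow> (v F \<longleftrightarrow> (\<forall>k\<in>K. v (f k)))" by blast
  have "v (\<lambda>i. JAnd (f k i) (F i)) \<longleftrightarrow> (\<forall>k\<in>insert k K. v (f k))" if "Val \<F> v" for v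
    using valuation_simps[OF that] F that by simp
  then show ?case by blast
qed

lemma ex_finite_disj:
  assumes "finite K"
  shows "\<exists>F. \<forall>v. Val \<F> v \<longrightarrow> (v F \<longleftrightarrow> (\<exists>k\<in>K. v (f k)))"
  using assms
proof induction
  case empty
  have "v (\<lambda>i. JBot) \<longleftrightarrow> (\<exists>k\<in>{}. v (f k))" if "Val \<F> v" for v
    using valuation_simps[OF that] by simp
  then show ?case by blast
next
  case (insert k K)
  then obtain F where F: "\<forall>v. Val \<F> v \<longrightarrow> (v F \<longleftrightarrow> (\<exists>k\<in>K. v (f k)))" by blast
  have "v (\<lambda>i. JOr (f k i) (F i)) \<longleftrightarrow> (\<exists>k\<in>insert k K. v (f k))" if "Val \<F> v" for v
    using valuation_simps[OF that] F that by simp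
  then show ?case by blast
qed

text \<open>Premises are moved one at a time into the goal as antecedents and discharged by
  \<open>App1\<close>; when none is left, \<open>Head\<close> makes a necessitation term first-sort.
  The term is chosen before \<open>v\<close>, so the resulting implication can itself be
  necessitated.\<close>

lemma modal_step:
  assumes "finite K" and "\<And>u. Val \<F> u \<Longrightarrow> (\<forall>(w, C)\<in>K. u C) \<Longrightarrow> u G"
  shows "\<exists>t. \<forall>v. Val \<F> v \<longrightarrow> (\<forall>(w, C)\<in>K. v (\<lambda>i. Just w (C i))) \<longrightarrow> v (\<lambda>i. Just t (G i))"
  using assms
proof (induction arbitrary: G)
  case empty
  have "\<exists>s. \<forall>v. Val \<F> v \<longrightarrow> v (\<lambda>i. JustTC s (G i))"
    by (rule Val_necessitation) (simp add: empty)
  then obtain s where s: "\<forall>v. Val \<F> v \<longrightarrow> v (\<lambda>i. JustTC s (G i))" ..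
  have "v (\<lambda>i. Just (Head s) (G i))" if "Val \<F> v" for v
    by (rule Val_Head[OF that s[THEN spec, THEN mp, OF that]])
  then show ?case by blast
next
  case (insert wC K)
  obtain w C where wC: "wC = (w, C)" by fastforce
  have "\<exists>t. \<forall>v. Val \<F> v \<longrightarrow> (\<forall>(w, C)\<in>K. v (\<lambda>i. Just w (C i))) \<longrightarrow> v (\<lambda>i. Just t (C i \<rightarrow>\<^sub>J G i))"
  proof (rule insert.IH)
    show "u (\<lambda>i. C i \<rightarrow>\<^sub>J G i)" if "Val \<F> u" "\<forall>(w, C)\<in>K. u C" for u
      using insert.prems[of u] that by (auto simp: wC valuation_imp[OF that(1)])
  qed
  then obtain t where t: "\<And>v. Val \<F> v \<Longrightarrow> \<forall>(w, C)\<in>K. v (\<lambda>i. Just w (C i)) \<Longrightarrow>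
    v (\<lambda>i. Just t (C i \<rightarrow>\<^sub>J G i))" by blast
  have "v (\<lambda>i. Just (App1 t w) (G i))"
    if v: "Val \<F> v" "\<forall>(w, C)\<in>insert wC K. v (\<lambda>i. Just w (C i))" for v
    by (rule Val_App1[OF v(1) t[OF v(1)]]) (use v(2) wC in auto)
  then show ?case by blast
qed

text \<open>Each alternative has its own term from \<open>modal_step\<close>; \<open>Plus1\<close>
  merges them into one that does not depend on which alternative holds.\<close>

lemma modal_step_disj:
  assumes "finite \<K>" and "\<And>K. K \<in> \<K> \<Longrightarrow> finite K"
    and "\<And>K u. K \<in> \<K> \<Longrightarrow> Val \<F> u \<Longrightarrow> (\<forall>(w, C)\<in>K. u C) \<Longrightarrow> u G"
  shows "\<exists>t. \<forall>v. Val \<F> v \<longrightarrow> (\<exists>K\<in>\<K>. \<forall>(w, C)\<in>K. v (\<lambda>i. Just w (C i))) \<longrightarrow> v (\<lambda>i. Just t (G i))"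
  using assms
proof induction
  case empty
  then show ?case by simp
next
  case (insert K \<K>)
  have "\<exists>t. \<forall>v. Val \<F> v \<longrightarrow> (\<exists>K\<in>\<K>. \<forall>(w, C)\<in>K. v (\<lambda>i. Just w (C i))) \<longrightarrow> v (\<lambda>i. Just t (G i))"
    by (rule insert.IH) (use insert.prems in blast)+
  moreover have "\<exists>t. \<forall>v. Val \<F> v \<longrightarrow> (\<forall>(w, C)\<in>K. v (\<lambda>i. Just w (C i))) \<longrightarrow> v (\<lambda>i. Just t (G i))"
    by (rule modal_step) (use insert.prems in blast)+
  ultimately obtain t t' where
    "\<And>v. Val \<F> v \<Longrightarrow> \<exists>K\<in>\<K>. \<forall>(w, C)\<in>K. v (\<lambda>i. Just w (C i)) \<Longrightarrow> v (\<lambda>i. Just t (G i))"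
    "\<And>v. Val \<F> v \<Longrightarrow> \<forall>(w, C)\<in>K. v (\<lambda>i. Just w (C i)) \<Longrightarrow> v (\<lambda>i. Just t' (G i))"
    by blast
  then have "v (\<lambda>i. Just (Plus1 t t') (G i))"
    if v: "Val \<F> v" "\<exists>K\<in>insert K \<K>. \<forall>(w, C)\<in>K. v (\<lambda>i. Just w (C i))" for v
    using v by (intro Val_Plus1[OF v(1)]) auto
  then show ?case by blast
qed

text \<open>Only assertions listed in \<open>N\<close> are transferred; for finite \<open>N\<close>,
  those true at a point can be expressed by one conjunction.\<close>

definition succ :: "'i filter \<Rightarrow> (jterm1 \<times> ('i \<Rightarrow> jfm)) set \<Rightarrow>
    (('i \<Rightarrow> jfm) \<Rightarrow> bool) \<Rightarrow> (('i \<Rightarrow> jfm) \<Rightarrow> bool) \<Rightarrow> bool" where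
  "succ \<F> N v u \<longleftrightarrow> Val \<F> u \<and> (\<forall>(w, C)\<in>N. v (\<lambda>i. Just w (C i)) \<longrightarrow> u C)"

lemma succ_Val: "succ \<F> N v u \<Longrightarrow> Val \<F> u"
  unfolding succ_def by (rule conjunct1)

lemma succD:
  assumes "succ \<F> N v u" "(w, C) \<in> N" "v (\<lambda>i. Just w (C i))"
  shows "u C"
  using bspec[OF conjunct2[OF assms(1)[unfolded succ_def]] assms(2)] assms(3) by simp

lemma succ_justified:
  assumes "finite N" "Val \<F> v" "\<And>u. succ \<F> N v u \<Longrightarrow> u G"
  shows "\<exists>t. v (\<lambda>i. Just t (G i))"
proof -
  let ?K = "{(w, C) \<in> N. v (\<lambda>i. Just w (C i))}"
  have "\<exists>t. \<forall>v. Val \<F> v \<longrightarrow> (\<forall>(w, C)\<in>?K. v (\<lambda>i. Just w (C i))) \<longrightarrow> v (\<lambda>i. Just t (G i))"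
  proof (rule modal_step)
    show "finite ?K" by (rule finite_subset[OF _ assms(1)]) auto
    show "u G" if "Val \<F> u" "\<forall>(w, C)\<in>?K. u C" for u
      by (rule assms(3)) (use that in \<open>auto simp: succ_def\<close>)
  qed
  then show ?thesis using assms(2) by blast
qed

lemma trancl_succ_justified:
  assumes N: "finite N" and v: "Val \<F> v" and G: "\<And>u. (succ \<F> N)\<^sup>+\<^sup>+ v u \<Longrightarrow> u G"
  shows "\<exists>t. v (\<lambda>i. JustTC t (G i))"
proof -
  \<comment> \<open>\<open>I\<close> says that some point reachable from \<open>v\<close> has all its true boxes true here; then every
    successor satisfies \<open>G\<close> and \<open>I\<close> again.\<close>
  define bx where "bx u = {(w, C) \<in> N. u (\<lambda>i. Just w (C i))}" for u :: "('a \<Rightarrow> jfm) \<Rightarrow> bool"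
  \<comment> \<open>Infinitely many points may be reachable, but \<open>bx\<close> takes finitely
    many values. The reflexive closure includes \<open>v\<close>, so that \<open>I\<close> holds at
    \<open>v\<close>.\<close>
  define \<K> where "\<K> = bx ` {u. (succ \<F> N)\<^sup>*\<^sup>* v u}"
  have \<K>: "\<K> \<subseteq> Pow N" by (auto simp: \<K>_def bx_def)
  then have fin: "finite \<K>" "\<And>K. K \<in> \<K> \<Longrightarrow> finite K"
    using N by (auto intro: finite_subset)
  have "\<forall>K\<in>\<K>. \<exists>F. \<forall>v. Val \<F> v \<longrightarrow> (v F \<longleftrightarrow> (\<forall>(w, C)\<in>K. v (\<lambda>i. Just w (C i))))"
    using ex_finite_conj[OF fin(2), where f = "\<lambda>(w, C) i. Just w (C i)"]
    by (simp add: case_prod_unfold)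
  then obtain f where f: "\<And>K v. K \<in> \<K> \<Longrightarrow> Val \<F> v \<Longrightarrow> v (f K) \<longleftrightarrow> (\<forall>(w, C)\<in>K. v (\<lambda>i. Just w (C i)))"
    by metis
  obtain I where "\<forall>u. Val \<F> u \<longrightarrow> (u I \<longleftrightarrow> (\<exists>K\<in>\<K>. u (f K)))"
    using ex_finite_disj[OF fin(1), where f = f] by blast
  then have I: "u I \<longleftrightarrow> (\<exists>K\<in>\<K>. \<forall>(w, C)\<in>K. u (\<lambda>i. Just w (C i)))" if "Val \<F> u" for u
    using f that by simp
  \<comment> \<open>The induction axiom wants its invariant at the successors of \<open>v\<close>,
    not at \<open>v\<close> itself. There \<open>I\<close> alone suffices, so \<open>G\<close> may
    fail at \<open>v\<close>.\<close>
  define H where "H = (\<lambda>i. JAnd (G i) (I i))"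
  have H: "u H \<longleftrightarrow> u G \<and> u I" if "Val \<F> u" for u
    using valuation_simps[OF that] by (simp add: H_def)
  have "\<exists>t. \<forall>v. Val \<F> v \<longrightarrow> (\<exists>K\<in>\<K>. \<forall>(w, C)\<in>K. v (\<lambda>i. Just w (C i))) \<longrightarrow> v (\<lambda>i. Just t (H i))"
  proof (rule modal_step_disj[OF fin])
    fix K u assume K: "K \<in> \<K>" and u: "Val \<F> u" "\<forall>(w, C)\<in>K. u C"
    obtain z where z: "(succ \<F> N)\<^sup>*\<^sup>* v z" "K = bx z" using K by (auto simp: \<K>_def)
    \<comment> \<open>Satisfying what is boxed at \<open>z\<close> makes \<open>u\<close> a
      successor of \<open>z\<close>, hence reachable from \<open>v\<close>: \<open>G\<close>
      applies, and \<open>bx u\<close> is itself one of the alternatives, which gives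
      \<open>I\<close>.\<close>
    then have "succ \<F> N z u" using u by (auto simp: succ_def bx_def)
    then have "(succ \<F> N)\<^sup>+\<^sup>+ v u" using z by auto
    then have "u G" "bx u \<in> \<K>" using G by (auto simp: \<K>_def)
    moreover have "\<forall>(w, C)\<in>bx u. u (\<lambda>i. Just w (C i))" by (auto simp: bx_def)
    ultimately show "u H" using H I u by blast
  qed
  then obtain w where w0: "\<forall>u. Val \<F> u \<longrightarrow> (\<exists>K\<in>\<K>. \<forall>(w, C)\<in>K. u (\<lambda>i. Just w (C i))) \<longrightarrow> u (\<lambda>i. Just w (H i))" ..
  have w: "u (\<lambda>i. Just w (H i))" if "Val \<F> u" "u I" for u
    by (rule w0[THEN spec, THEN mp, THEN mp, OF that(1) iffD1[OF I[OF that(1)] that(2)]])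
  have "\<exists>s. \<forall>u. Val \<F> u \<longrightarrow> u (\<lambda>i. JustTC s (H i \<rightarrow>\<^sub>J Just w (H i)))"
  proof (rule Val_necessitation)
    show "u (\<lambda>i. H i \<rightarrow>\<^sub>J Just w (H i))" if "Val \<F> u" for u
      using w[OF that] H[OF that] by (simp add: valuation_imp[OF that])
  qed
  then obtain s where s: "\<forall>u. Val \<F> u \<longrightarrow> u (\<lambda>i. JustTC s (H i \<rightarrow>\<^sub>J Just w (H i)))" ..
  have "\<exists>r. \<forall>u. Val \<F> u \<longrightarrow> u (\<lambda>i. JustTC r (H i \<rightarrow>\<^sub>J G i))"
  proof (rule Val_necessitation)
    show "u (\<lambda>i. H i \<rightarrow>\<^sub>J G i)" if "Val \<F> u" for u
      using H[OF that] by (simp add: valuation_imp[OF that])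
  qed
  then obtain r where r: "\<forall>u. Val \<F> u \<longrightarrow> u (\<lambda>i. JustTC r (H i \<rightarrow>\<^sub>J G i))" ..
  have "bx v \<in> \<K>" "\<forall>(w, C)\<in>bx v. v (\<lambda>i. Just w (C i))" by (auto simp: \<K>_def bx_def)
  then have "v I" using I[OF v] by blast
  then have "v (\<lambda>i. Just w (H i))" by (rule w[OF v])
  then have "v (\<lambda>i. JustTC (Ind w s) (H i))"
    by (rule Val_Ind[OF v]) (rule s[THEN spec, THEN mp, OF v])
  then have "v (\<lambda>i. JustTC (App2 r (Ind w s)) (G i))"
    by (rule Val_App2[OF v r[THEN spec, THEN mp, OF v]])
  then show ?thesis by (rule exI)
qed

section \<open>Sums of initial segments of the terms\<close>

text \<open>The sums are nested to the right, so that the \<open>k\<close>-th summand is reached in \<open>k + 1\<close> steps however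
  long the sum is.\<close>

definition sum1 :: "nat \<Rightarrow> nat \<Rightarrow> jterm1" where
  "sum1 k n = foldr (\<lambda>i. Plus1 (from_nat i)) [k..<n] (X 0)"

definition sum2 :: "nat \<Rightarrow> nat \<Rightarrow> jterm2" where
  "sum2 k n = foldr (\<lambda>i. Plus2 (from_nat i)) [k..<n] (Y 0)"

lemma sum1_rec: "k < n \<Longrightarrow> sum1 k n = Plus1 (from_nat k) (sum1 (Suc k) n)"
  and sum2_rec: "k < n \<Longrightarrow> sum2 k n = Plus2 (from_nat k) (sum2 (Suc k) n)"
  by (simp_all add: sum1_def sum2_def upt_conv_Cons)

text \<open>The recursion for the sum needs \<open>k < n\<close>; \<open>sequentially\<close>
  ignores the finitely many other \<open>n\<close>.\<close>

lemma Val_sum1_step: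
  assumes v: "Val sequentially v"
    and "v (\<lambda>n. Just (from_nat k) (B n)) \<or> v (\<lambda>n. Just (sum1 (Suc k) n) (B n))"
  shows "v (\<lambda>n. Just (sum1 k n) (B n))"
proof -
  have "v (\<lambda>n. JOr (Just (from_nat k) (B n)) (Just (sum1 (Suc k) n) (B n)) \<rightarrow>\<^sub>J Just (sum1 k n) (B n))"
  proof (rule valuation_sound[OF v], rule uprov_axiom)
    show "\<forall>\<^sub>F n in sequentially. J0_axiom (JOr (Just (from_nat k) (B n)) (Just (sum1 (Suc k) n) (B n)) \<rightarrow>\<^sub>J Just (sum1 k n) (B n))"
      using eventually_gt_at_top[of k] by eventually_elim (simp add: sum1_rec J0_axiom.intros)
  qed
  then show ?thesis using assms(2) by (auto simp: valuation_simps[OF v])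
qed

lemma Val_sum2_step:
  assumes v: "Val sequentially v"
    and "v (\<lambda>n. JustTC (from_nat k) (B n)) \<or> v (\<lambda>n. JustTC (sum2 (Suc k) n) (B n))"
  shows "v (\<lambda>n. JustTC (sum2 k n) (B n))"
proof -
  have "v (\<lambda>n. JOr (JustTC (from_nat k) (B n)) (JustTC (sum2 (Suc k) n) (B n)) \<rightarrow>\<^sub>J JustTC (sum2 k n) (B n))"
  proof (rule valuation_sound[OF v], rule uprov_axiom)
    show "\<forall>\<^sub>F n in sequentially. J0_axiom (JOr (JustTC (from_nat k) (B n)) (JustTC (sum2 (Suc k) n) (B n)) \<rightarrow>\<^sub>J JustTC (sum2 k n) (B n))"
      using eventually_gt_at_top[of k] by eventually_elim (simp add: sum2_rec J0_axiom.intros)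
  qed
  then show ?thesis using assms(2) by (auto simp: valuation_simps[OF v])
qed

text \<open>\<open>t\<close> is summand number \<open>to_nat t\<close>; the descent from there to 0
  has a length independent of \<open>n\<close>.\<close>

lemma Val_sum1:
  assumes v: "Val sequentially v" and "v (\<lambda>n. Just t (B n))"
  shows "v (\<lambda>n. Just (sum1 0 n) (B n))"
proof -
  have "v (\<lambda>n. Just (sum1 k n) (B n))" if "k \<le> to_nat t" for k
    using that
  proof (induction rule: inc_induct)
    case base
    show ?case by (rule Val_sum1_step[OF v], rule disjI1) (simp add: assms)
  next
    case (step k)
    show ?case by (rule Val_sum1_step[OF v], rule disjI2) (rule step.IH)
  qed
  then show ?thesis by simp
qed

lemma Val_sum2:
  assumes v: "Val sequentially v" and "v (\<lambda>n. JustTC t (B n))"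
  shows "v (\<lambda>n. JustTC (sum2 0 n) (B n))"
proof -
  have "v (\<lambda>n. JustTC (sum2 k n) (B n))" if "k \<le> to_nat t" for k
    using that
  proof (induction rule: inc_induct)
    case base
    show ?case by (rule Val_sum2_step[OF v], rule disjI1) (simp add: assms)
  next
    case (step k)
    show ?case by (rule Val_sum2_step[OF v], rule disjI2) (rule step.IH)
  qed
  then show ?thesis by simp
qed

section \<open>The canonical realization\<close>

text \<open>\<open>p\<close> is the path to the current subformula, latest step first; its code
  tells occurrences apart. The sums may contain the same variables, since normality constrains
  negative occurrences only.\<close>

fun canonical :: "bool \<Rightarrow> bool list \<Rightarrow> mfm \<Rightarrow> nat \<Rightarrow> jfm" where
  "canonical neg p (MVar i) = (\<lambda>n. JVar i)"
| "canonical neg p MBot = (\<lambda>n. JBot)"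
| "canonical neg p (A \<rightarrow>\<^sub>K B) = (\<lambda>n. canonical (\<not> neg) (True # p) A n \<rightarrow>\<^sub>J canonical neg (False # p) B n)"
| "canonical neg p (Box A) = (\<lambda>n. Just (if neg then X (to_nat p) else sum1 0 n) (canonical neg (True # p) A n))"
| "canonical neg p (BoxP A) = (\<lambda>n. JustTC (if neg then Y (to_nat p) else sum2 0 n) (canonical neg (True # p) A n))"

text \<open>A pair \<open>(w, C)\<close> stands for the assertion \<open>[w]C\<close>. A negative \<open>[y]\<^sub>t\<^sub>cC\<close> contributes the two assertions
  that it implies by the head and tail axioms; the second one propagates it along successors.\<close>

fun neg_boxes :: "bool \<Rightarrow> bool list \<Rightarrow> mfm \<Rightarrow> (jterm1 \<times> (nat \<Rightarrow> jfm)) set" where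
  "neg_boxes neg p (MVar i) = {}"
| "neg_boxes neg p MBot = {}"
| "neg_boxes neg p (A \<rightarrow>\<^sub>K B) = neg_boxes (\<not> neg) (True # p) A \<union> neg_boxes neg (False # p) B"
| "neg_boxes neg p (Box A) =
    (if neg then {(X (to_nat p), canonical neg (True # p) A)} else {}) \<union> neg_boxes neg (True # p) A"
| "neg_boxes neg p (BoxP A) =
    (if neg then {(Head (Y (to_nat p)), canonical neg (True # p) A),
      (Tail (Y (to_nat p)), canonical neg p (BoxP A))} else {}) \<union> neg_boxes neg (True # p) A"

lemma finite_neg_boxes: "finite (neg_boxes neg p A)"
  by (induction A arbitrary: neg p) auto

text \<open>The \<open>Tail\<close> assertion hands the formula justified by \<open>s\<close> on to
  each successor, where the \<open>Head\<close> assertion yields \<open>C\<close>.\<close>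

lemma trancl_succ_true:
  assumes "(succ \<F> N)\<^sup>+\<^sup>+ v u" "Val \<F> v" "v (\<lambda>i. JustTC s (C i))"
    and N: "(Head s, C) \<in> N" "(Tail s, \<lambda>i. JustTC s (C i)) \<in> N"
  shows "u C"
proof -
  have preserve: "y C \<and> y (\<lambda>i. JustTC s (C i)) \<and> Val \<F> y"
    if "succ \<F> N x y" "Val \<F> x" "x (\<lambda>i. JustTC s (C i))" for x y
    using succD[OF that(1) N(1) Val_Head[OF that(2,3)]] succD[OF that(1) N(2) Val_Tail[OF that(2,3)]]
      succ_Val[OF that(1)] by simp
  have "u C \<and> u (\<lambda>i. JustTC s (C i)) \<and> Val \<F> u"
    using assms(1)
  proof induction
    case (base y)
    show ?case by (rule preserve[OF base assms(2,3)])
  next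
    case (step y z)
    then show ?case using preserve[OF step.hyps(2)] by simp
  qed
  then show ?thesis ..
qed

section \<open>The truth lemma\<close>

abbreviation csat :: "(jterm1 \<times> (nat \<Rightarrow> jfm)) set \<Rightarrow> ((nat \<Rightarrow> jfm) \<Rightarrow> bool) \<Rightarrow> mfm \<Rightarrow> bool" where
  "csat N \<equiv> ksat (succ sequentially N) (\<lambda>u i. u (\<lambda>n. JVar i))"

lemma truth_lemma:
  assumes "finite N" "neg_boxes neg p A \<subseteq> N" "Val sequentially v"
  shows "if neg then v (canonical neg p A) \<longrightarrow> csat N v A else csat N v A \<longrightarrow> v (canonical neg p A)"
  using assms(2,3)
proof (induction A arbitrary: neg p v)
  case (MVar i)
  show ?case by simp
next
  case MBot
  show ?case using valuation_bot[OF MBot.prems(2)] by simp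
next
  case (MImp A B)
  have "neg_boxes (\<not> neg) (True # p) A \<subseteq> N" "neg_boxes neg (False # p) B \<subseteq> N"
    using MImp.prems(1) by auto
  from MImp.IH(1)[OF this(1) MImp.prems(2)] MImp.IH(2)[OF this(2) MImp.prems(2)]
  show ?case by (cases neg) (simp_all add: valuation_imp[OF MImp.prems(2)])
next
  case (Box A)
  let ?G = "canonical neg (True # p) A"
  have sub: "neg_boxes neg (True # p) A \<subseteq> N" using Box.prems(1) by auto
  note IH = Box.IH[OF sub succ_Val]
  show ?case
  proof (cases neg)
    case True
    have "csat N u A" if "v (canonical neg p (Box A))" "succ sequentially N v u" for u
    proof -
      have "(X (to_nat p), ?G) \<in> N" using True Box.prems(1) by simp
      moreover have "v (\<lambda>n. Just (X (to_nat p)) (?G n))" using that(1) True by simp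
      ultimately have "u ?G" by (rule succD[OF that(2)])
      then show ?thesis using IH[OF that(2)] True by simp
    qed
    then show ?thesis using True by simp
  next
    case False
    have "v (canonical neg p (Box A))" if sat: "csat N v (Box A)"
    proof -
      have "u ?G" if "succ sequentially N v u" for u
        using IH[OF that] sat that False by simp
      then have "\<exists>t. v (\<lambda>n. Just t (?G n))"
        by (rule succ_justified[OF assms(1) Box.prems(2)])
      then obtain t where "v (\<lambda>n. Just t (?G n))" ..
      \<comment> \<open>The term \<open>t\<close> may depend on \<open>v\<close>; the sum absorbs
        any such term.\<close>
      from Val_sum1[OF Box.prems(2) this] show ?thesis using False by simp
    qed
    then show ?thesis using False by simp
  qed
next
  case (BoxP A)
  let ?G = "canonical neg (True # p) A"
  have sub: "neg_boxes neg (True # p) A \<subseteq> N" using BoxP.prems(1) by auto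
  have Val: "Val sequentially u" if "(succ sequentially N)\<^sup>+\<^sup>+ v u" for u
    using that by cases (erule succ_Val)+
  note IH = BoxP.IH[OF sub Val]
  show ?case
  proof (cases neg)
    case True
    have "csat N u A" if "v (canonical neg p (BoxP A))" "(succ sequentially N)\<^sup>+\<^sup>+ v u" for u
    proof -
      have "v (\<lambda>n. JustTC (Y (to_nat p)) (?G n))" using that(1) True by simp
      moreover have "(Head (Y (to_nat p)), ?G) \<in> N"
        "(Tail (Y (to_nat p)), \<lambda>n. JustTC (Y (to_nat p)) (?G n)) \<in> N"
        using True BoxP.prems(1) by simp_all
      ultimately have "u ?G" by (rule trancl_succ_true[OF that(2) BoxP.prems(2)])
      then show ?thesis using IH[OF that(2)] True by simp
    qed
    then show ?thesis using True by simp
  next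
    case False
    have "v (canonical neg p (BoxP A))" if sat: "csat N v (BoxP A)"
    proof -
      have "u ?G" if "(succ sequentially N)\<^sup>+\<^sup>+ v u" for u
        using IH[OF that] sat that False by simp
      then have "\<exists>t. v (\<lambda>n. JustTC t (?G n))"
        by (rule trancl_succ_justified[OF assms(1) BoxP.prems(2)])
      then obtain t where "v (\<lambda>n. JustTC t (?G n))" ..
      from Val_sum2[OF BoxP.prems(2) this] show ?thesis using False by simp
    qed
    then show ?thesis using False by simp
  qed
qed

lemma K_provable_uprov:
  assumes "K_provable A"
  shows "uprov sequentially (canonical False p A)"
proof (rule uprov.valuation_complete)
  fix v assume "Val sequentially v"
  from truth_lemma[OF finite_neg_boxes subset_refl this, of False p A] K_sound[OF assms, of "succ sequentially (neg_boxes False p A)" "\<lambda>u i. u (\<lambda>n. JVar i)" v]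
  show "v (canonical False p A)" by (simp only: if_False)
qed

section \<open>Normality of the canonical realization\<close>

lemma realization_canonical: "realization (canonical neg p A n) A"
  by (induction A arbitrary: neg p) (auto intro: realization.intros)

text \<open>The two sides of an implication use paths ending in \<open>True # p\<close> and
  \<open>False # p\<close>, and everything below a modality uses paths longer than \<open>p\<close>,
  so no variable repeats.\<close>

lemma neg_terms_canonical:
  "set (neg_terms1 neg (canonical neg p A n)) \<subseteq> {X (to_nat (q @ p)) |q. True} \<and>
    distinct (neg_terms1 neg (canonical neg p A n))"
  "set (neg_terms2 neg (canonical neg p A n)) \<subseteq> {Y (to_nat (q @ p)) |q. True} \<and>
    distinct (neg_terms2 neg (canonical neg p A n))"
proof (induction A arbitrary: neg p)
  case (MImp A B)
  { case 1 show ?case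
      using MImp(1)[of "\<not> neg" "True # p"] MImp(3)[of neg "False # p"]
      by (fastforce simp: subset_iff) }
  { case 2 show ?case
      using MImp(2)[of "\<not> neg" "True # p"] MImp(4)[of neg "False # p"]
      by (fastforce simp: subset_iff) }
next
  case (Box A)
  { case 1 show ?case using Box(1)[of neg "True # p"] by (fastforce simp: subset_iff) }
  { case 2 show ?case using Box(2)[of neg "True # p"] by (fastforce simp: subset_iff) }
next
  case (BoxP A)
  { case 1 show ?case using BoxP(1)[of neg "True # p"] by (fastforce simp: subset_iff) }
  { case 2 show ?case using BoxP(2)[of neg "True # p"] by (fastforce simp: subset_iff) }
qed auto

lemma normal_realization_canonical: "normal_realization (canonical False p A n) A"
  unfolding normal_realization_def
  using realization_canonical neg_terms_canonical[of False p A n] by blast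

section \<open>Making proofs injective\<close>

primrec csub1 :: "jterm2 \<Rightarrow> jterm1 \<Rightarrow> jterm1" and csub2 :: "jterm2 \<Rightarrow> jterm2 \<Rightarrow> jterm2" where
  "csub1 d (X i) = X i"
| "csub1 d (App1 h w) = App1 (csub1 d h) (csub1 d w)"
| "csub1 d (Head s) = Head (csub2 d s)"
| "csub1 d (Tail s) = Tail (csub2 d s)"
| "csub1 d (Plus1 h w) = Plus1 (csub1 d h) (csub1 d w)"
| "csub2 d (Y i) = Y i"
| "csub2 d (Const i) = d"
| "csub2 d (App2 t s) = App2 (csub2 d t) (csub2 d s)"
| "csub2 d (Ind w s) = Ind (csub1 d w) (csub2 d s)"
| "csub2 d (Plus2 t s) = Plus2 (csub2 d t) (csub2 d s)"

primrec csub :: "jterm2 \<Rightarrow> jfm \<Rightarrow> jfm" where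
  "csub d (JVar i) = JVar i"
| "csub d JBot = JBot"
| "csub d (A \<rightarrow>\<^sub>J B) = csub d A \<rightarrow>\<^sub>J csub d B"
| "csub d (Just w A) = Just (csub1 d w) (csub d A)"
| "csub d (JustTC s A) = JustTC (csub2 d s) (csub d A)"

lemma J0_axiom_csub: "J0_axiom A \<Longrightarrow> J0_axiom (csub d A)"
  by (induction rule: J0_axiom.induct) (simp_all add: J0_axiom.intros)

lemma realization_csub: "realization B A \<Longrightarrow> realization (csub d B) A"
  by (induction rule: realization.induct) (auto intro: realization.intros)

lemma neg_terms_csub:
  "neg_terms1 neg (csub d B) = map (csub1 d) (neg_terms1 neg B)"
  "neg_terms2 neg (csub d B) = map (csub2 d) (neg_terms2 neg B)"
  by (induction B arbitrary: neg) auto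

text \<open>Terms at negative occurrences are variables, which \<open>csub\<close> fixes.\<close>

lemma normal_realization_csub:
  assumes "normal_realization B A"
  shows "normal_realization (csub d B) A"
proof -
  have "neg_terms1 False (csub d B) = neg_terms1 False B"
    unfolding neg_terms_csub by (rule map_idI) (use assms in \<open>auto simp: normal_realization_def\<close>)
  moreover have "neg_terms2 False (csub d B) = neg_terms2 False B"
    unfolding neg_terms_csub by (rule map_idI) (use assms in \<open>auto simp: normal_realization_def\<close>)
  ultimately show ?thesis
    using assms by (simp add: normal_realization_def realization_csub)
qed

definition provable_within :: "jfm set \<Rightarrow> jfm \<Rightarrow> bool" where
  "provable_within S B \<longleftrightarrow> (\<exists>\<pi>. J_proof_of \<pi> B \<and> cs \<pi> \<subseteq> S)"

text \<open>Every such axiom is an implication, so the one-leaf proof uses no constant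
  axiom.\<close>

lemma provable_within_J0: "J0_axiom A \<Longrightarrow> provable_within S A"
  unfolding provable_within_def
  by (rule exI[of _ "Axiom A"])
    (auto simp: cs_def intro: J_proof_of.intros J_axiom.intros elim: J0_axiom.cases)

lemma provable_within_const:
  "J0_axiom A \<Longrightarrow> JustTC (Const c) A \<in> S \<Longrightarrow> provable_within S (JustTC (Const c) A)"
  unfolding provable_within_def
  by (rule exI[of _ "Axiom (JustTC (Const c) A)"])
    (auto simp: cs_def intro: J_proof_of.intros J_axiom.intros)

lemma provable_within_MP:
  "provable_within S A \<Longrightarrow> provable_within S (A \<rightarrow>\<^sub>J B) \<Longrightarrow> provable_within S B"
  unfolding provable_within_def
  by (fastforce simp: cs_def intro: J_proof_of.intros)

text \<open>Families over \<open>unit\<close> are single formulas, so completeness can replace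
  explicit propositional derivations.\<close>

interpretation provable_within: hilbert "\<lambda>F :: unit \<Rightarrow> jfm. provable_within S (F ())" for S
  by unfold_locales (auto intro: provable_within_J0 provable_within_MP)

lemma provable_within_Plus2:
  assumes "provable_within S (JustTC t A) \<or> provable_within S (JustTC s A)"
  shows "provable_within S (JustTC (Plus2 t s) A)"
proof -
  let ?Q = "\<lambda>F :: unit \<Rightarrow> jfm. provable_within S (F ())"
  have "?Q (\<lambda>_. JOr (JustTC t A) (JustTC s A))"
  proof (rule provable_within.valuation_complete)
    fix v assume v: "valuation ?Q v"
    show "v (\<lambda>_. JOr (JustTC t A) (JustTC s A))"
      using assms valuation_sound[OF v, of "\<lambda>_. JustTC t A"] valuation_sound[OF v, of "\<lambda>_. JustTC s A"]
      by (auto simp: valuation_or[OF v])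
  qed
  then show ?thesis
    using provable_within_MP provable_within_J0[OF J0_axiom.intros(10)] by blast
qed

primrec const_sum :: "nat \<Rightarrow> jterm2" where
  "const_sum 0 = Const 0"
| "const_sum (Suc n) = Plus2 (Const (Suc n)) (const_sum n)"

lemma provable_within_const_sum:
  "k \<le> n \<Longrightarrow> provable_within S (JustTC (Const k) A) \<Longrightarrow> provable_within S (JustTC (const_sum n) A)"
  by (induction n) (auto simp: le_Suc_eq intro: provable_within_Plus2)

text \<open>The tree is kept: substituted J0 leaves are axioms again, and constant leaves are
  replaced by the given proofs.\<close>

lemma provable_within_csub:
  assumes "J_proof_of \<pi> B"
    and "\<And>c A. J0_axiom A \<Longrightarrow> JustTC (Const c) A \<in> axioms_used \<pi> \<Longrightarrow> provable_within S (JustTC d (csub d A))"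
  shows "provable_within S (csub d B)"
  using assms
proof (induction rule: J_proof_of.induct)
  case (1 A)
  then show ?case
    by (auto elim!: J_axiom.cases intro: provable_within_J0 J0_axiom_csub)
next
  case (2 \<pi> A \<rho> B)
  then show ?case by (fastforce intro: provable_within_MP[where A = "csub d A"])
qed

lemma finite_axioms_used: "finite (axioms_used \<pi>)"
  by (induction \<pi>) auto

text \<open>The substituted axioms may contain \<open>d\<close> themselves. This is not circular:
  \<open>d\<close> depends only on the number of axioms, so it is fixed before constants are
  assigned to the substituted axioms.\<close>

lemma ex_injective_proof:
  assumes "J_proof_of \<pi> B"
  shows "\<exists>d \<rho>. J_proof_of \<rho> (csub d B) \<and> injective_proof \<rho>"
proof -
  obtain xs where xs: "set xs = axioms_used \<pi>"
    using finite_list[OF finite_axioms_used] by blast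
  \<comment> \<open>The summands run from \<open>Const 0\<close> to
    \<open>Const (length xs)\<close>, so every position in \<open>xs\<close> has its own
    constant.\<close>
  let ?d = "const_sum (length xs)"
  \<comment> \<open>The value is unspecified where \<open>xs ! k\<close> is not a
    \<open>JustTC\<close> formula; only positions of constant axioms are looked up.\<close>
  let ?A = "\<lambda>k. csub ?d (case xs ! k of JustTC s A \<Rightarrow> A)"
  \<comment> \<open>One formula per constant, so every proof within \<open>?S\<close> is
    injective.\<close>
  let ?S = "range (\<lambda>k. JustTC (Const k) (?A k))"
  have "provable_within ?S (csub ?d B)"
  proof (rule provable_within_csub[OF assms])
    fix c A assume A: "J0_axiom A" "JustTC (Const c) A \<in> axioms_used \<pi>"
    then obtain k where k: "k < length xs" "xs ! k = JustTC (Const c) A"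
      unfolding xs[symmetric] in_set_conv_nth by blast
    have "provable_within ?S (JustTC (Const k) (csub ?d A))"
      by (rule provable_within_const) (use A k in \<open>auto intro: J0_axiom_csub rev_image_eqI[of k]\<close>)
    then show "provable_within ?S (JustTC ?d (csub ?d A))"
      using k by (intro provable_within_const_sum[of k]) auto
  qed
  then obtain \<rho> where "J_proof_of \<rho> (csub ?d B)" "cs \<rho> \<subseteq> ?S"
    unfolding provable_within_def by blast
  moreover from this(2) have "injective_proof \<rho>"
    unfolding injective_proof_def by blast
  ultimately show ?thesis by blast
qed

lemma derives_J_proof: "derives s A \<Longrightarrow> \<exists>\<pi>. J_proof_of \<pi> A"
  by (induction rule: derives.induct) (blast intro: J_proof_of.intros J_axiom.intros)+

theorem mainTheorem1:
  fixes A :: mfm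
  assumes "K_provable A"
  shows "\<exists>B. normal_realization B A \<and> (\<exists>\<pi>. J_proof_of \<pi> B \<and> injective_proof \<pi>)"
proof -
  \<comment> \<open>A single large \<open>n\<close> is fixed here, turning the family into one
    realization.\<close>
  obtain s n where "derives s (canonical False [] A n)"
    using K_provable_uprov[OF assms, of "[]"] unfolding uprov_def eventually_sequentially by blast
  then obtain \<pi> where "J_proof_of \<pi> (canonical False [] A n)"
    using derives_J_proof by blast
  then show ?thesis
    using ex_injective_proof normal_realization_csub[OF normal_realization_canonical] by blast
qed

end
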